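(* Let $\alpha>0$ and $\gamma>-1$, and let $w_{\alpha,\gamma}(x)=|x|^{2\gamma+1}(1-x^2)^\alpha$, $x\in(-1,1)$, be the Konoplev weight. If $\gamma\neq-\tfrac12$, then $w_{\alpha,\gamma}$ is not symmetrically separable. (For $\gamma=-\tfrac12$ the weight is the ultraspherical weight.)
   Context: Let $\{p_n\}_{n\in\mathbb{Z}_+}$, $\mathbb{Z}_+=\{0,1,2,\dots\}$, be the orthonormal polynomials with respect to $w_{\alpha,\gamma}$ on $(-1,1)$, $\varphi_n=\sqrt{w_{\alpha,\gamma}}\,p_n$, and $\mathcal{D}_{m,n}=\int_{-1}^1\varphi_m'(x)\varphi_n(x)\,dx$ the differentiation matrix (by symmetry $\mathcal{D}_{m,n}=0$ for $m+n$ even, if necessary in the principal value sense). A weight is symmetrically separable if there exist real sequences $\{\mathfrak{a}_n\}_{n\in\mathbb{Z}_+},\{\mathfrak{b}_n\}_{n\in\mathbb{Z}_+}$ such that $\mathcal{D}_{m,n}=0$ for $m+n$ even and, for $m+n$ odd, $\mathcal{D}_{m,n}=-\mathfrak{a}_m\mathfrak{b}_n$ if $m\ge n+1$ and $\mathcal{D}_{m,n}=\mathfrak{a}_n\mathfrak{b}_m$ if $m\le n-1$. *)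

theory Defs
  imports "HOL-Analysis.Analysis" "HOL-Computational_Algebra.Polynomial"
begin

definition konoplev_weight :: "real \<Rightarrow> real \<Rightarrow> real \<Rightarrow> real" where
  "konoplev_weight \<alpha> \<gamma> x = \<bar>x\<bar> powr (2 * \<gamma> + 1) * (1 - x\<^sup>2) powr \<alpha>"

(* No sign normalisation of the leading coefficients is imposed; it is immaterial for separability,
   since replacing p n by s n * p n with s n = 1 or s n = - 1 turns a n, b n into s n * a n, s n * b n. *)
definition orthonormal_polys :: "(real \<Rightarrow> real) \<Rightarrow> (nat \<Rightarrow> real poly) \<Rightarrow> bool" where
  "orthonormal_polys w p \<longleftrightarrow>
     (\<forall>n. degree (p n) = n) \<and>
     (\<forall>m n. set_integrable lborel {-1<..<1} (\<lambda>x. w x * poly (p m) x * poly (p n) x) \<and>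
            (LBINT x:{-1<..<1}. w x * poly (p m) x * poly (p n) x) = (if m = n then 1 else 0))"

definition phi :: "(real \<Rightarrow> real) \<Rightarrow> (nat \<Rightarrow> real poly) \<Rightarrow> nat \<Rightarrow> real \<Rightarrow> real" where
  "phi w p n x = sqrt (w x) * poly (p n) x"

(* The integral over (-1,1), in the sense of a principal value at the origin when the integrand
   is not absolutely integrable. *)
definition pv_integral :: "(real \<Rightarrow> real) \<Rightarrow> real" where
  "pv_integral f =
     (if set_integrable lborel {-1<..<1} f then LBINT x:{-1<..<1}. f x
      else Lim (at_right 0) (\<lambda>\<epsilon>. LBINT x:{-1<..<-\<epsilon>} \<union> {\<epsilon><..<1}. f x))"

definition diff_matrix :: "(real \<Rightarrow> real) \<Rightarrow> (nat \<Rightarrow> real poly) \<Rightarrow> nat \<Rightarrow> nat \<Rightarrow> real" where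
  "diff_matrix w p m n = pv_integral (\<lambda>x. deriv (phi w p m) x * phi w p n x)"

definition symmetrically_separable :: "(real \<Rightarrow> real) \<Rightarrow> bool" where
  "symmetrically_separable w \<longleftrightarrow>
     (\<exists>p. orthonormal_polys w p \<and>
        (\<exists>a b :: nat \<Rightarrow> real. \<forall>m n.
           (even (m + n) \<longrightarrow> diff_matrix w p m n = 0) \<and>
           (odd (m + n) \<longrightarrow>
              (m \<ge> n + 1 \<longrightarrow> diff_matrix w p m n = - a m * b n) \<and>
              (m + 1 \<le> n \<longrightarrow> diff_matrix w p m n = a n * b m))))"

end

theory Submission
  imports Defs
begin

text \<open>
  Write \<open>w\<close> for the weight. For even \<open>n\<close> and odd \<open>m > n\<close>, separability says that the entry
  \<open>D n m = \<integral> \<phi> n' * \<phi> m\<close> of the differentiation matrix is \<open>a m * b n\<close>. The rows 0 and 2 and the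
  columns 3 and 5 already contradict this, because their two by two block is nonsingular.

  Indeed, \<open>\<phi> n' * \<phi> m = w * (p n' + h * p n) * p m\<close> with \<open>h = (\<gamma> + 1/2) / x - \<alpha> * x / (1 - x\<^sup>2)\<close>.
  By parity \<open>p m\<close> has a factor \<open>x\<close>, so both poles of \<open>h\<close> can be absorbed: \<open>D n m\<close> is the integral of a
  polynomial against the integrable weight \<open>U = w / (1 - x\<^sup>2)\<close>, which is the same kind of weight with
  \<open>\<alpha> - 1\<close> in place of \<open>\<alpha>\<close> (lemma \<open>diff_matrix_konoplev\<close>).

  If the block were singular, a nontrivial combination \<open>x * q\<close> of \<open>p 3\<close> and \<open>p 5\<close> would be annihilated by both rows.
  Reducing modulo what is orthogonal to \<open>x * q\<close>, row \<open>n\<close> becomes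
  \<open>(\<gamma> + 1/2) * p n 0 * A - \<alpha> * p n 1 * B\<close> with \<open>A = \<integral> U * (1 - x\<^sup>2) * q\<close> and
  \<open>B = \<integral> U * x\<^sup>2 * q\<close>. As \<open>p 0\<close> is constant and \<open>p 2\<close> is not, and neither \<open>\<gamma> + 1/2\<close> nor \<open>\<alpha>\<close> is
  zero, \<open>A = B = 0\<close>. Orthogonality of \<open>p 3\<close> and \<open>p 5\<close> to \<open>x\<close> gives also
  \<open>\<integral> U * x\<^sup>2 * (1 - x\<^sup>2) * q = 0\<close>. The three multipliers span the even polynomials of degree at most 4, and
  \<open>q\<close> is one of them. So \<open>\<integral> U * q\<^sup>2 = 0\<close> and \<open>q = 0\<close>, which is impossible (lemma \<open>even_quartic_eq_0\<close>).
\<close>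

section \<open>Integrability of the weight\<close>

lemma powr_le_2_if_exponent_gt_minus_1:
  fixes t a :: real
  assumes "1/2 \<le> t" "t \<le> 1" "a > -1"
  shows "t powr a \<le> 2"
proof -
  have "t powr a \<le> t powr (-1)"
    using assms powr_mono'[of "-1" a t] by simp
  also have "\<dots> \<le> 2"
    using assms by (simp add: powr_minus field_simps)
  finally show ?thesis .
qed

lemma konoplev_weight_nonneg: "konoplev_weight \<beta> \<gamma> x \<ge> 0"
  by (simp add: konoplev_weight_def)

lemma konoplev_weight_minus [simp]: "konoplev_weight \<beta> \<gamma> (- x) = konoplev_weight \<beta> \<gamma> x"
  by (simp add: konoplev_weight_def)

lemma borel_measurable_konoplev_weight [measurable]:
  "konoplev_weight \<beta> \<gamma> \<in> borel_measurable borel"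
  unfolding konoplev_weight_def by measurable

text \<open>
  On \<open>{0<..<1}\<close> the weight is at most
  \<open>2 * x powr (2 * \<gamma> + 1) + 2 * (x * (1 - x\<^sup>2) powr \<beta>)\<close>: when \<open>x\<^sup>2 \<le> 1/2\<close>
  the factor \<open>(1 - x\<^sup>2) powr \<beta>\<close> is at most 2, and otherwise \<open>(x\<^sup>2) powr \<gamma>\<close> is at most 2.
  Both terms of the bound have explicit antiderivatives with finite limits at 0 and 1.
\<close>

lemma konoplev_weight_integrable:
  assumes "\<beta> > -1" "\<gamma> > -1"
  shows "set_integrable lborel {-1<..<1} (konoplev_weight \<beta> \<gamma>)"
proof -
  let ?w = "konoplev_weight \<beta> \<gamma>"
  have "set_integrable lborel (einterval (ereal 0) (ereal 1)) (\<lambda>x. x powr (2 * \<gamma> + 1))"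
  proof (rule interval_integral_FTC_nonneg(1)[where F = "\<lambda>x. x powr (2 * \<gamma> + 2) / (2 * \<gamma> + 2)"
        and A = 0 and B = "1 / (2 * \<gamma> + 2)"])
    show "DERIV (\<lambda>x. x powr (2 * \<gamma> + 2) / (2 * \<gamma> + 2)) x :> x powr (2 * \<gamma> + 1)"
      if "ereal 0 < ereal x" "ereal x < ereal 1" for x
    proof -
      have *: "2 * \<gamma> + 2 - 1 = 2 * \<gamma> + 1" by simp
      show ?thesis
        using that assms by (auto intro!: derivative_eq_intros simp: *)
    qed
    have "((\<lambda>x::real. x powr (2 * \<gamma> + 2) / (2 * \<gamma> + 2)) \<longlongrightarrow> 0 powr (2 * \<gamma> + 2) / (2 * \<gamma> + 2)) (at_right 0)"
      using assms by (intro tendsto_intros tendsto_powr') (auto simp: eventually_at_filter)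
    then show "(((\<lambda>x. x powr (2 * \<gamma> + 2) / (2 * \<gamma> + 2)) \<circ> real_of_ereal) \<longlongrightarrow> 0) (at_right (ereal 0))"
      by (simp add: ereal_tendsto_simps1)
    have "((\<lambda>x::real. x powr (2 * \<gamma> + 2) / (2 * \<gamma> + 2)) \<longlongrightarrow> 1 powr (2 * \<gamma> + 2) / (2 * \<gamma> + 2)) (at_left 1)"
      using assms by (intro tendsto_intros) auto
    then show "(((\<lambda>x. x powr (2 * \<gamma> + 2) / (2 * \<gamma> + 2)) \<circ> real_of_ereal) \<longlongrightarrow> 1 / (2 * \<gamma> + 2)) (at_left (ereal 1))"
      by (simp add: ereal_tendsto_simps1 del: one_ereal_def)
  qed (auto intro!: continuous_intros)
  then have near0: "set_integrable lborel {0<..<1} (\<lambda>x::real. x powr (2 * \<gamma> + 1))"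
    by simp
  have sq1: "x\<^sup>2 < 1" if "0 < x" "x < 1" for x :: real
    using that by (simp add: power_less_one_iff)
  have "set_integrable lborel (einterval (ereal 0) (ereal 1)) (\<lambda>x. x * (1 - x\<^sup>2) powr \<beta>)"
  proof (rule interval_integral_FTC_nonneg(1)[where F = "\<lambda>x. - ((1 - x\<^sup>2) powr (\<beta> + 1)) / (2 * \<beta> + 2)"
        and A = "- 1 / (2 * \<beta> + 2)" and B = 0])
    show "DERIV (\<lambda>x. - ((1 - x\<^sup>2) powr (\<beta> + 1)) / (2 * \<beta> + 2)) x :> x * (1 - x\<^sup>2) powr \<beta>"
      if "ereal 0 < ereal x" "ereal x < ereal 1" for x
    proof -
      have "((\<lambda>x. - ((1 - x\<^sup>2) powr (\<beta> + 1)) / (2 * \<beta> + 2)) has_real_derivative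
          - ((\<beta> + 1) * (1 - x\<^sup>2) powr (\<beta> + 1 - 1) * (- (2 * x))) / (2 * \<beta> + 2)) (at x)"
        using that assms sq1[of x] by (auto intro!: derivative_eq_intros)
      also have "- ((\<beta> + 1) * (1 - x\<^sup>2) powr (\<beta> + 1 - 1) * (- (2 * x))) / (2 * \<beta> + 2) =
          (2 * \<beta> + 2) * (x * (1 - x\<^sup>2) powr \<beta>) / (2 * \<beta> + 2)"
        by (simp add: algebra_simps)
      also have "\<dots> = x * (1 - x\<^sup>2) powr \<beta>"
        using assms by simp
      finally show ?thesis .
    qed
    have "((\<lambda>x::real. - ((1 - x\<^sup>2) powr (\<beta> + 1)) / (2 * \<beta> + 2)) \<longlongrightarrow>
        - ((1 - 0\<^sup>2) powr (\<beta> + 1)) / (2 * \<beta> + 2)) (at_right 0)"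
      using assms by (intro tendsto_intros) auto
    then show "(((\<lambda>x. - ((1 - x\<^sup>2) powr (\<beta> + 1)) / (2 * \<beta> + 2)) \<circ> real_of_ereal) \<longlongrightarrow>
        - 1 / (2 * \<beta> + 2)) (at_right (ereal 0))"
      by (simp add: ereal_tendsto_simps1)
    have "\<forall>\<^sub>F x::real in at_left 1. x \<in> {0<..<1}"
      by (rule eventually_at_left_real) simp
    then have "\<forall>\<^sub>F x::real in at_left 1. 0 \<le> 1 - x\<^sup>2"
      by eventually_elim (use sq1 in \<open>auto intro: less_imp_le\<close>)
    then have "((\<lambda>x::real. - ((1 - x\<^sup>2) powr (\<beta> + 1)) / (2 * \<beta> + 2)) \<longlongrightarrow>
        - ((1 - 1\<^sup>2) powr (\<beta> + 1)) / (2 * \<beta> + 2)) (at_left 1)"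
      using assms by (intro tendsto_intros tendsto_powr') auto
    then show "(((\<lambda>x. - ((1 - x\<^sup>2) powr (\<beta> + 1)) / (2 * \<beta> + 2)) \<circ> real_of_ereal) \<longlongrightarrow> 0) (at_left (ereal 1))"
      by (simp add: ereal_tendsto_simps1 del: one_ereal_def)
    show "isCont (\<lambda>x. x * (1 - x\<^sup>2) powr \<beta>) x" if "ereal 0 < ereal x" "ereal x < ereal 1" for x
      using that sq1[of x] by (auto intro!: continuous_intros)
  qed auto
  then have near1: "set_integrable lborel {0<..<1} (\<lambda>x::real. x * (1 - x\<^sup>2) powr \<beta>)"
    by simp
  have "?w x \<le> 2 * x powr (2 * \<gamma> + 1) + 2 * (x * (1 - x\<^sup>2) powr \<beta>)" if x: "0 < x" "x < 1" for x
  proof (cases "x\<^sup>2 \<le> 1/2")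
    case True
    have "?w x \<le> x powr (2 * \<gamma> + 1) * 2"
      unfolding konoplev_weight_def
      using x True assms
      by (auto intro!: mult_left_mono powr_le_2_if_exponent_gt_minus_1)
    moreover have "0 \<le> x * (1 - x\<^sup>2) powr \<beta>"
      using x by simp
    ultimately show ?thesis by linarith
  next
    case False
    have "x powr (2 * \<gamma> + 1) = x * (x\<^sup>2) powr \<gamma>"
      using x by (simp add: powr_add powr_powr flip: powr_numeral)
    also have "\<dots> \<le> x * 2"
      using x False assms sq1[of x]
      by (intro mult_left_mono powr_le_2_if_exponent_gt_minus_1) auto
    finally have "?w x \<le> (x * 2) * (1 - x\<^sup>2) powr \<beta>"
      unfolding konoplev_weight_def using x by (intro mult_right_mono) auto
    moreover have "0 \<le> x powr (2 * \<gamma> + 1)"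
      by simp
    ultimately show ?thesis by linarith
  qed
  then have pos: "set_integrable lborel {0<..<1} ?w"
    using near0 near1 konoplev_weight_nonneg
    by (intro set_integrable_bound[where g = ?w and
          f = "\<lambda>x. 2 * x powr (2 * \<gamma> + 1) + 2 * (x * (1 - x\<^sup>2) powr \<beta>)"])
      (auto simp: set_borel_measurable_def intro!: set_integral_add AE_I2)
  have "integrable lborel (\<lambda>x. indicator {0<..<1} (0 + -1 * x) *\<^sub>R ?w (0 + -1 * x))"
    using pos unfolding set_integrable_def by (rule lborel_integrable_real_affine) simp
  then have neg: "set_integrable lborel {-1<..<0} ?w"
    unfolding set_integrable_def
    by (rule Bochner_Integration.integrable_cong[THEN iffD1, rotated 2])
      (auto simp: indicator_def of_bool_def)
  have "(\<lambda>x. indicator {0} x *\<^sub>R ?w x) = (\<lambda>_. 0)"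
    by (auto simp: fun_eq_iff indicator_def konoplev_weight_def)
  then have zero: "set_integrable lborel {0} ?w"
    unfolding set_integrable_def by simp
  have "{-1<..<1} = {-1<..<0} \<union> {0} \<union> {0<..<1::real}"
    by auto
  then show ?thesis
    using pos neg zero by (simp add: set_integrable_Un del: Un_insert_right)
qed

section \<open>The positive functional of the weight and its orthonormal polynomials\<close>

definition konoplev_functional :: "real \<Rightarrow> real \<Rightarrow> real poly \<Rightarrow> real" where
  "konoplev_functional \<beta> \<gamma> f = (LBINT x:{-1<..<1}. konoplev_weight \<beta> \<gamma> x * poly f x)"

lemma konoplev_weight_poly_integrable:
  assumes "\<beta> > -1" "\<gamma> > -1"
  shows "set_integrable lborel {-1<..<1} (\<lambda>x. konoplev_weight \<beta> \<gamma> x * poly f x)"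
proof -
  have "compact (poly f ` {-1..1})"
    by (intro compact_continuous_image continuous_intros) auto
  then obtain B where B: "\<And>x. x \<in> {-1..1} \<Longrightarrow> \<bar>poly f x\<bar> \<le> B"
    using compact_imp_bounded bounded_iff by (metis imageI real_norm_def)
  have [measurable]: "poly f \<in> borel_measurable borel"
    by (intro borel_measurable_continuous_onI continuous_intros)
  have "\<bar>konoplev_weight \<beta> \<gamma> x * poly f x\<bar> \<le> \<bar>B * konoplev_weight \<beta> \<gamma> x\<bar>"
    if "x \<in> {-1<..<1}" for x
  proof -
    have "\<bar>poly f x\<bar> \<le> \<bar>B\<bar>"
      using B[of x] that by auto
    then have "\<bar>poly f x\<bar> * \<bar>konoplev_weight \<beta> \<gamma> x\<bar> \<le> \<bar>B\<bar> * \<bar>konoplev_weight \<beta> \<gamma> x\<bar>"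
      by (rule mult_right_mono) simp
    then show ?thesis
      by (simp add: abs_mult mult.commute)
  qed
  then show ?thesis
    using konoplev_weight_integrable[OF assms]
    by (intro set_integrable_bound[where f = "\<lambda>x. B * konoplev_weight \<beta> \<gamma> x" and
          g = "\<lambda>x. konoplev_weight \<beta> \<gamma> x * poly f x"])
      (auto simp: set_borel_measurable_def)
qed

lemma konoplev_functional_even:
  "konoplev_functional \<beta> \<gamma> (pcompose f [:0, -1:]) = konoplev_functional \<beta> \<gamma> f"
proof -
  have "{x. - x \<in> {-1<..<1}} = {-1<..<1::real}"
    by auto
  then show ?thesis
    unfolding konoplev_functional_def
    by (subst (2) set_integral_reflect) (simp add: poly_pcompose)
qed

text \<open>
  Raising the exponent \<open>\<beta>\<close> by one is multiplication of the argument by \<open>1 - x\<^sup>2\<close>. This is how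
  the pole of \<open>w' / w\<close> at \<open>1\<close> and \<open>-1\<close> disappears: everything is expressed by the one functional
  with exponent \<open>\<alpha> - 1\<close>, at polynomial arguments.
\<close>

lemma konoplev_functional_lift:
  "konoplev_functional (\<beta> + 1) \<gamma> f = konoplev_functional \<beta> \<gamma> ([:1, 0, -1:] * f)"
proof -
  have "konoplev_weight (\<beta> + 1) \<gamma> x * poly f x =
        konoplev_weight \<beta> \<gamma> x * poly ([:1, 0, -1:] * f) x" if "x \<in> {-1<..<1}" for x
  proof -
    have "x\<^sup>2 < 1"
      using that by (simp add: abs_square_less_1 abs_less_iff)
    then show ?thesis
      by (simp add: konoplev_weight_def powr_add power2_eq_square algebra_simps)
  qed
  then show ?thesis
    unfolding konoplev_functional_def by (intro set_lebesgue_integral_cong) auto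
qed

context
  fixes \<beta> \<gamma> :: real
  assumes params: "\<beta> > -1" "\<gamma> > -1"
begin

lemma konoplev_functional_add:
  "konoplev_functional \<beta> \<gamma> (f + g) = konoplev_functional \<beta> \<gamma> f + konoplev_functional \<beta> \<gamma> g"
  unfolding konoplev_functional_def
  by (simp add: distrib_left konoplev_weight_poly_integrable params)

lemma konoplev_functional_smult:
  "konoplev_functional \<beta> \<gamma> (smult c f) = c * konoplev_functional \<beta> \<gamma> f"
  unfolding konoplev_functional_def
  by (simp add: mult.left_commute)

lemma konoplev_functional_diff:
  "konoplev_functional \<beta> \<gamma> (f - g) = konoplev_functional \<beta> \<gamma> f - konoplev_functional \<beta> \<gamma> g"
  unfolding konoplev_functional_def
  by (simp add: right_diff_distrib konoplev_weight_poly_integrable params)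

lemma konoplev_functional_definite:
  assumes "konoplev_functional \<beta> \<gamma> (f * f) = 0"
  shows "f = 0"
proof (rule ccontr)
  assume "f \<noteq> 0"
  let ?w = "konoplev_weight \<beta> \<gamma>"
  have "AE x in lborel. indicator {-1<..<1} x *\<^sub>R (?w x * poly (f * f) x) = 0"
    using assms konoplev_weight_poly_integrable[OF params, of "f * f"]
    unfolding konoplev_functional_def set_lebesgue_integral_def set_integrable_def
    by (subst (asm) integral_nonneg_eq_0_iff_AE) (auto simp: konoplev_weight_nonneg)
  then have "AE x in lborel. x \<in> {-1<..<1} \<longrightarrow> x \<in> insert 0 {x. poly f x = 0}"
  proof eventually_elim
    case (elim x)
    have "x\<^sup>2 < 1" if "x \<in> {-1<..<1}"
      using that by (simp add: abs_square_less_1 abs_less_iff)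
    with elim show ?case
      by (auto simp: konoplev_weight_def)
  qed
  moreover have "finite (insert 0 {x. poly f x = 0})"
    using \<open>f \<noteq> 0\<close> poly_roots_finite by blast
  then have "insert 0 {x. poly f x = 0} \<in> null_sets lborel"
    by (rule finite_imp_null_set_lborel)
  then have "AE x in lborel. x \<notin> insert 0 {x. poly f x = 0}"
    by (rule AE_not_in)
  ultimately have "AE x in lborel. x \<notin> {-1<..<1::real}"
    by eventually_elim auto
  then have "emeasure lborel {-1<..<1::real} = 0"
    by (subst (asm) AE_iff_measurable[where N = "{-1<..<1}"]) auto
  then show False
    by simp
qed

context
  fixes p :: "nat \<Rightarrow> real poly"
  assumes orthonormal: "orthonormal_polys (konoplev_weight \<beta> \<gamma>) p"
begin

lemma orthonormal_polys_orthogonal: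
  assumes "degree f < n"
  shows "konoplev_functional \<beta> \<gamma> (f * p n) = 0"
  using assms
proof (induction "degree f" arbitrary: f rule: less_induct)
  case less
  define d where "d = degree f"
  have deg: "degree (p d) = d"
    using orthonormal by (simp add: orthonormal_polys_def)
  have basis: "konoplev_functional \<beta> \<gamma> (p d * p n) = 0"
    using orthonormal less.prems
    by (simp add: orthonormal_polys_def konoplev_functional_def d_def mult.assoc)
  show ?case
  proof (cases "p d = 0")
    case True
    then have "(LBINT x:{-1<..<1}. konoplev_weight \<beta> \<gamma> x * poly (p d) x * poly (p d) x) = 0"
      by simp
    then show ?thesis
      using orthonormal by (simp add: orthonormal_polys_def)
  next
    case False
    define c where "c = lead_coeff f / lead_coeff (p d)"
    define g where "g = f - smult c (p d)"
    have f: "f = smult c (p d) + g"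
      by (simp add: g_def)
    have "degree g \<le> d"
      unfolding g_def using deg by (intro degree_diff_le) (auto simp: d_def)
    moreover have "coeff (p d) d \<noteq> 0"
      using False deg leading_coeff_0_iff by metis
    then have "coeff g d = 0"
      using deg by (simp add: g_def c_def d_def)
    ultimately have "g = 0 \<or> degree g < d"
      by (metis eq_zero_or_degree_less)
    then have "konoplev_functional \<beta> \<gamma> (g * p n) = 0"
      using less.hyps[of g] less.prems konoplev_functional_smult[of 0 0] by (auto simp: d_def)
    then show ?thesis
      by (subst f) (simp add: distrib_right konoplev_functional_add konoplev_functional_smult basis)
  qed
qed

text \<open>
  Reflection preserves the functional, so the reflected \<open>p n\<close> is again orthogonal to all polynomials
  of smaller degree. The difference \<open>d\<close> below has degree less than \<open>n\<close>, hence is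
  orthogonal to both of its own terms and so to itself.
\<close>

lemma orthonormal_polys_parity:
  "pcompose (p n) [:0, -1:] = smult ((-1) ^ n) (p n)"
proof (cases "n = 0")
  case True
  then have "degree (p n) = 0"
    using orthonormal by (simp add: orthonormal_polys_def)
  then show ?thesis
    using True by (metis degree_eq_zeroE pcompose_const power_0 smult_1_left)
next
  case False
  let ?r = "\<lambda>f. pcompose f [:0, -1::real:]"
  define d where "d = ?r (p n) - smult ((-1) ^ n) (p n)"
  have deg: "degree (p n) = n"
    using orthonormal by (simp add: orthonormal_polys_def)
  have "degree (?r (p n)) = n"
    by (simp add: degree_pcompose deg)
  moreover have "lead_coeff (?r (p n)) = (-1) ^ n * lead_coeff (p n)"
    by (subst lead_coeff_comp) (auto simp: deg)
  ultimately have "degree d \<le> n" "coeff d n = 0"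
    by (auto simp: d_def deg intro!: degree_diff_le)
  then have "degree d < n"
    using False by (metis degree_0 eq_zero_or_degree_less neq0_conv)
  then have "konoplev_functional \<beta> \<gamma> (d * p n) = 0" "konoplev_functional \<beta> \<gamma> (?r d * p n) = 0"
    by (auto intro!: orthonormal_polys_orthogonal simp: degree_pcompose)
  moreover have "?r (?r f) = f" for f :: "real poly"
    by (simp add: pcompose_assoc[symmetric] pcompose_pCons pcompose_idR)
  then have "konoplev_functional \<beta> \<gamma> (?r d * p n) = konoplev_functional \<beta> \<gamma> (d * ?r (p n))"
    using konoplev_functional_even[of \<beta> \<gamma> "d * ?r (p n)"] by (simp add: pcompose_mult)
  moreover have "d * d = d * (?r (p n) - smult ((-1) ^ n) (p n))"
    by (simp add: d_def)
  then have "d * d = d * ?r (p n) - smult ((-1) ^ n) (d * p n)"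
    by (simp add: right_diff_distrib)
  ultimately have "konoplev_functional \<beta> \<gamma> (d * d) = 0"
    by (simp add: konoplev_functional_diff konoplev_functional_smult)
  then have "d = 0"
    by (rule konoplev_functional_definite)
  then show ?thesis
    by (simp add: d_def)
qed

lemma orthonormal_polys_coeff_eq_0:
  assumes "odd (n + k)"
  shows "coeff (p n) k = 0"
proof -
  have "coeff (pcompose (p n) [:0, -1:]) k = (-1) ^ k * coeff (p n) k"
    by (rule coeff_pcompose_linear)
  then show ?thesis
    using orthonormal_polys_parity[of n] assms by (auto simp: minus_one_power_iff split: if_splits)
qed

end

end

section \<open>Entries of the differentiation matrix\<close>

text \<open>
  Away from the origin \<open>\<surd>w\<close> is \<open>exp\<close> of a combination of \<open>ln (x\<^sup>2)\<close> and \<open>ln (1 - x\<^sup>2)\<close>, whose derivative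
  \<open>(\<gamma> + 1/2) / x - \<alpha> * x / (1 - x\<^sup>2)\<close> is half the logarithmic derivative of the weight.
\<close>

lemma phi_konoplev_has_derivative:
  fixes p :: "nat \<Rightarrow> real poly"
  assumes "x \<in> {-1<..<1}" "x \<noteq> 0"
  shows "(phi (konoplev_weight \<alpha> \<gamma>) p n has_real_derivative
          sqrt (konoplev_weight \<alpha> \<gamma> x) *
            (poly (pderiv (p n)) x + ((\<gamma> + 1/2) / x - \<alpha> * x / (1 - x\<^sup>2)) * poly (p n) x)) (at x)"
proof -
  define h where "h x = exp ((\<gamma> + 1/2) / 2 * ln (x\<^sup>2) + \<alpha> / 2 * ln (1 - x\<^sup>2))" for x :: real
  have sq1: "y\<^sup>2 < 1" if "y \<in> {-1<..<1}" for y :: real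
    using that by (simp add: abs_square_less_1 abs_less_iff)
  have h: "sqrt (konoplev_weight \<alpha> \<gamma> y) = h y" if "y \<in> {-1<..<1} - {0}" for y
  proof (rule real_sqrt_unique)
    have "ln (y\<^sup>2) = 2 * ln \<bar>y\<bar>"
      using that ln_realpow[of "\<bar>y\<bar>" 2] by simp
    then show "(h y)\<^sup>2 = konoplev_weight \<alpha> \<gamma> y"
      using that sq1[of y]
      by (simp add: h_def konoplev_weight_def powr_def exp_add[symmetric] power2_eq_square algebra_simps)
  qed (simp add: h_def)
  have "(h has_real_derivative h x * ((\<gamma> + 1/2) / 2 * (2 * x / x\<^sup>2) + \<alpha> / 2 * (- (2 * x) / (1 - x\<^sup>2)))) (at x)"
  proof -
    have "((\<lambda>y. ln (y\<^sup>2)) has_real_derivative 2 * x / x\<^sup>2) (at x)"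
      using assms by (auto intro!: derivative_eq_intros)
    moreover have "((\<lambda>y. ln (1 - y\<^sup>2)) has_real_derivative - (2 * x) / (1 - x\<^sup>2)) (at x)"
      using assms sq1[of x] by (auto intro!: derivative_eq_intros)
    ultimately show ?thesis
      unfolding h_def by (intro DERIV_fun_exp DERIV_add DERIV_cmult)
  qed
  also have "(\<gamma> + 1/2) / 2 * (2 * x / x\<^sup>2) + \<alpha> / 2 * (- (2 * x) / (1 - x\<^sup>2)) =
      (\<gamma> + 1/2) / x - \<alpha> * x / (1 - x\<^sup>2)"
  proof -
    have "(\<gamma> + 1/2) / 2 * (2 * x / x\<^sup>2) = (\<gamma> + 1/2) / x"
      using assms by (simp add: power2_eq_square field_simps)
    then show ?thesis
      by simp
  qed
  finally have "((\<lambda>y. h y * poly (p n) y) has_real_derivative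
      h x * (poly (pderiv (p n)) x + ((\<gamma> + 1/2) / x - \<alpha> * x / (1 - x\<^sup>2)) * poly (p n) x)) (at x)"
    by (rule DERIV_mult[OF _ poly_DERIV, THEN DERIV_cong]) (simp add: algebra_simps)
  moreover have "sqrt (konoplev_weight \<alpha> \<gamma> x) = h x"
    using assms h by simp
  ultimately have "((\<lambda>y. h y * poly (p n) y) has_real_derivative
      sqrt (konoplev_weight \<alpha> \<gamma> x) *
        (poly (pderiv (p n)) x + ((\<gamma> + 1/2) / x - \<alpha> * x / (1 - x\<^sup>2)) * poly (p n) x)) (at x)"
    by simp
  then show ?thesis
    by (rule has_field_derivative_transform_within_open[where S = "{-1<..<1} - {0}"])
      (use assms h in \<open>auto simp: phi_def\<close>)
qed

text \<open>
  The value of \<open>\<integral> (\<surd>w * f)' * (\<surd>w * g)\<close> for \<open>g = x * r\<close>: the factor \<open>x\<close> of \<open>g\<close> cancels the pole of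
  \<open>w' / w\<close> at the origin. Taking \<open>r\<close> rather than \<open>g\<close> as the argument makes the form
  visibly linear, so that it applies to combinations of several \<open>p m\<close>.
\<close>

definition konoplev_diff_form :: "real \<Rightarrow> real \<Rightarrow> real poly \<Rightarrow> real poly \<Rightarrow> real" where
  "konoplev_diff_form \<alpha> \<gamma> f r = konoplev_functional (\<alpha> - 1) \<gamma>
     ([:1, 0, -1:] * [:0, 1:] * pderiv f * r + smult (\<gamma> + 1/2) ([:1, 0, -1:] * f * r)
       - smult \<alpha> ([:0, 0, 1:] * f * r))"

text \<open>
  The integrand agrees with an integrable function except at the origin, where \<open>deriv\<close> may be an arbitrary
  value. Hence the integral converges absolutely and the principal value does not enter.
\<close>

lemma diff_matrix_konoplev:
  assumes "\<alpha> > 0" "\<gamma> > -1" and r: "p m = [:0, 1:] * r"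
  shows "diff_matrix (konoplev_weight \<alpha> \<gamma>) p n m = konoplev_diff_form \<alpha> \<gamma> (p n) r"
proof -
  define F where "F = [:1, 0, -1:] * [:0, 1:] * pderiv (p n) * r +
      smult (\<gamma> + 1/2) ([:1, 0, -1:] * p n * r) - smult \<alpha> ([:0, 0, 1:] * p n * r)"
  let ?w = "konoplev_weight \<alpha> \<gamma>"
  let ?g = "\<lambda>x. indicator {-1<..<1} x *\<^sub>R (konoplev_weight (\<alpha> - 1) \<gamma> x * poly F x)"
  let ?d = "\<lambda>x. indicator {-1<..<1} x *\<^sub>R (deriv (phi ?w p n) x * phi ?w p m x)"
  have expand: "T * ((P + (c / x - \<alpha> * x / T) * f) * (x * s)) =
      T * x * P * s + c * (x / x) * (T * f * s) - \<alpha> * (T / T) * (x * x * f * s)" for T P c x f s :: real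
    by (simp add: algebra_simps)
  have eq: "deriv (phi ?w p n) x * phi ?w p m x = konoplev_weight (\<alpha> - 1) \<gamma> x * poly F x"
    if x: "x \<in> {-1<..<1}" "x \<noteq> 0" for x
  proof -
    have sq1: "x\<^sup>2 < 1"
      using x by (simp add: abs_square_less_1 abs_less_iff)
    then have w: "?w x = (1 - x\<^sup>2) * konoplev_weight (\<alpha> - 1) \<gamma> x"
      by (simp add: konoplev_weight_def powr_diff)
    have "deriv (phi ?w p n) x * phi ?w p m x = (sqrt (?w x) * sqrt (?w x)) *
        ((poly (pderiv (p n)) x + ((\<gamma> + 1/2) / x - \<alpha> * x / (1 - x\<^sup>2)) * poly (p n) x) * poly (p m) x)"
      by (simp add: DERIV_imp_deriv[OF phi_konoplev_has_derivative[OF x]] phi_def[of _ _ m])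
    also have "\<dots> = konoplev_weight (\<alpha> - 1) \<gamma> x * ((1 - x\<^sup>2) *
        ((poly (pderiv (p n)) x + ((\<gamma> + 1/2) / x - \<alpha> * x / (1 - x\<^sup>2)) * poly (p n) x) * (x * poly r x)))"
      by (simp add: konoplev_weight_nonneg r) (simp add: w)
    also have "(1 - x\<^sup>2) *
        ((poly (pderiv (p n)) x + ((\<gamma> + 1/2) / x - \<alpha> * x / (1 - x\<^sup>2)) * poly (p n) x) * (x * poly r x)) =
        (1 - x\<^sup>2) * x * poly (pderiv (p n)) x * poly r x
        + (\<gamma> + 1/2) * (x / x) * ((1 - x\<^sup>2) * poly (p n) x * poly r x)
        - \<alpha> * ((1 - x\<^sup>2) / (1 - x\<^sup>2)) * (x * x * poly (p n) x * poly r x)"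
      by (rule expand)
    also have "\<dots> = poly F x"
      using x sq1 by (simp add: F_def power2_eq_square algebra_simps)
    finally show ?thesis .
  qed
  \<comment> \<open>Measurability of the derivative comes from this exact equality; almost everywhere
      equality alone does not give it for Borel sets.\<close>
  then have d: "?d = (\<lambda>x. if x = 0 then ?d 0 else ?g x)"
    by (auto simp: fun_eq_iff indicator_def)
  have g: "integrable lborel ?g"
    using konoplev_weight_poly_integrable[of "\<alpha> - 1" \<gamma> F] assms by (simp add: set_integrable_def)
  then have g_meas [measurable]: "?g \<in> borel_measurable lborel"
    by (rule borel_measurable_integrable)
  have d_meas: "?d \<in> borel_measurable lborel"
    by (subst d) measurable
  have AE: "AE x in lborel. ?d x = ?g x"
    using AE_lborel_singleton[of 0] by eventually_elim (auto simp: eq indicator_def)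
  then have "integrable lborel ?d"
    using g integrable_cong_AE[OF d_meas g_meas] by simp
  moreover have "integral\<^sup>L lborel ?d = integral\<^sup>L lborel ?g"
    by (rule integral_cong_AE[OF d_meas g_meas AE])
  ultimately show ?thesis
    by (simp add: diff_matrix_def pv_integral_def set_integrable_def set_lebesgue_integral_def
        konoplev_diff_form_def konoplev_functional_def F_def)
qed

section \<open>Non-separability\<close>

context
  fixes \<alpha> \<gamma> :: real
  assumes params: "\<alpha> > 0" "\<gamma> > -1"
begin

lemma params': "\<alpha> - 1 > -1" "\<gamma> > -1"
  using params by auto

lemma konoplev_diff_form_linear:
  "konoplev_diff_form \<alpha> \<gamma> f (smult c r + smult d s) =
     c * konoplev_diff_form \<alpha> \<gamma> f r + d * konoplev_diff_form \<alpha> \<gamma> f s"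
  unfolding konoplev_diff_form_def konoplev_functional_smult[OF params', symmetric]
    konoplev_functional_add[OF params', symmetric]
  by (rule arg_cong[where f = "konoplev_functional _ _"])
    (simp add: smult_add_right smult_diff_right distrib_left mult.commute algebra_simps del: mult_pCons_left)

text \<open>
  The heart of the argument. With \<open>M\<close> the functional of exponent \<open>\<alpha> - 1\<close>, \<open>T = 1 - x\<^sup>2\<close>, \<open>S = x\<^sup>2\<close>,
  \<open>A = M (T * q)\<close> and \<open>B = M (S * q)\<close>, the two vanishing rows are linear equations for
  \<open>(\<gamma> + 1/2) * A\<close> and \<open>\<alpha> * B\<close>. They are independent because \<open>e0 + e2 * x\<^sup>2\<close>
  takes different values at 0 and 1. So \<open>A = B = 0\<close>, and \<open>M (T * S * q) = 0\<close> is the orthogonality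
  hypothesis. Since \<open>T\<close>, \<open>S\<close> and \<open>T * S\<close> span the even quartics, \<open>q\<close> is
  orthogonal to itself.
\<close>

lemma even_quartic_eq_0:
  assumes nondeg: "\<gamma> \<noteq> - 1/2" "k \<noteq> 0" "e2 \<noteq> 0"
    and q: "q = [:s, 0, t, 0, u:]"
    and orth: "konoplev_functional \<alpha> \<gamma> ([:0, 0, 1:] * q) = 0"
    and row0: "konoplev_diff_form \<alpha> \<gamma> [:k:] q = 0"
    and row2: "konoplev_diff_form \<alpha> \<gamma> [:e0, 0, e2:] q = 0"
  shows "q = 0"
proof -
  let ?M = "konoplev_functional (\<alpha> - 1) \<gamma>"
  let ?T = "[:1, 0, -1:] :: real poly" and ?S = "[:0, 0, 1:] :: real poly"
  note M = konoplev_functional_add[OF params'] konoplev_functional_diff[OF params']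
    konoplev_functional_smult[OF params']
  define A where "A = ?M (?T * q)"
  define B where "B = ?M (?S * q)"
  have C: "?M (?T * ?S * q) = 0"
    using konoplev_functional_lift[of "\<alpha> - 1" \<gamma> "?S * q"] orth by (simp only: diff_add_cancel mult.assoc)
  have "?T * [:0, 1:] * pderiv [:k:] * q + smult (\<gamma> + 1/2) (?T * [:k:] * q) - smult \<alpha> (?S * [:k:] * q) =
      smult (k * (\<gamma> + 1/2)) (?T * q) - smult (k * \<alpha>) (?S * q)"
    by (subst poly_eq_poly_eq_iff[symmetric]) (simp add: fun_eq_iff pderiv_pCons algebra_simps)
  then have "k * ((\<gamma> + 1/2) * A - \<alpha> * B) = 0"
    using row0 by (simp only: konoplev_diff_form_def M A_def B_def) (simp add: algebra_simps)
  then have eq0: "(\<gamma> + 1/2) * A = \<alpha> * B"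
    using nondeg by simp
  have "?T * [:0, 1:] * pderiv [:e0, 0, e2:] * q + smult (\<gamma> + 1/2) (?T * [:e0, 0, e2:] * q)
        - smult \<alpha> (?S * [:e0, 0, e2:] * q) =
      smult (e0 * (\<gamma> + 1/2)) (?T * q) - smult ((e0 + e2) * \<alpha>) (?S * q)
        + smult (e2 * (\<gamma> + 1/2 + 2 + \<alpha>)) (?T * ?S * q)"
    by (subst poly_eq_poly_eq_iff[symmetric]) (simp add: fun_eq_iff pderiv_pCons algebra_simps)
  then have "e0 * ((\<gamma> + 1/2) * A) - (e0 + e2) * (\<alpha> * B) = 0"
    using row2 by (simp only: konoplev_diff_form_def M A_def B_def C)
  then have "e2 * (\<alpha> * B) = 0"
    unfolding eq0 by (simp add: algebra_simps)
  then have "B = 0"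
    using nondeg params by simp
  then have "A = 0"
    using eq0 nondeg by auto
  have "q * q = smult s (?T * q) + smult (s + t + u) (?S * q) - smult u (?T * ?S * q)"
  proof -
    have "q = smult s ?T + smult (s + t + u) ?S - smult u (?T * ?S)"
      by (simp add: q)
    then have "q * q = (smult s ?T + smult (s + t + u) ?S - smult u (?T * ?S)) * q"
      by simp
    then show ?thesis
      by (simp only: distrib_right left_diff_distrib mult_smult_left)
  qed
  then have "?M (q * q) = s * A + (s + t + u) * B - u * ?M (?T * ?S * q)"
    by (simp only: M A_def B_def)
  then have "?M (q * q) = 0"
    using \<open>A = 0\<close> \<open>B = 0\<close> C by simp
  then show ?thesis
    by (rule konoplev_functional_definite[OF params'])
qed

end

lemma poly_degree_le_5:
  fixes f :: "'a :: comm_ring_1 poly"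
  assumes "degree f \<le> 5"
  shows "f = [:coeff f 0, coeff f 1, coeff f 2, coeff f 3, coeff f 4, coeff f 5:]"
proof (rule poly_eqI)
  fix i
  have "coeff f i = 0" if "i > 5"
    using that assms by (intro coeff_eq_0) simp
  then show "coeff f i = coeff [:coeff f 0, coeff f 1, coeff f 2, coeff f 3, coeff f 4, coeff f 5:] i"
    by (auto simp: coeff_pCons numeral_eq_Suc split: nat.split)
qed

theorem mainTheorem11:
  fixes \<alpha> \<gamma> :: real
  assumes "\<alpha> > 0" and "\<gamma> > -1" and "\<gamma> \<noteq> - 1 / 2"
  shows "\<not> symmetrically_separable (konoplev_weight \<alpha> \<gamma>)"
proof
  let ?w = "konoplev_weight \<alpha> \<gamma>"
  assume "symmetrically_separable ?w"
  then obtain p a b where orth: "orthonormal_polys ?w p"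
    and sep: "\<And>m n. odd (m + n) \<Longrightarrow> n + 1 \<le> m \<Longrightarrow> diff_matrix ?w p n m = a m * b n"
    unfolding symmetrically_separable_def by (metis add.commute)
  have params: "\<alpha> > -1" "\<gamma> > -1"
    using assms by auto
  have deg: "degree (p n) = n" for n
    using orth by (simp add: orthonormal_polys_def)
  note parity = orthonormal_polys_coeff_eq_0[OF params orth]
  have expand: "p n = [:coeff (p n) 0, coeff (p n) 1, coeff (p n) 2, coeff (p n) 3, coeff (p n) 4, coeff (p n) 5:]"
    if "n \<le> 5" for n
    using that by (intro poly_degree_le_5) (simp add: deg)
  have vanish: "coeff (p n) k = 0" if "n < k" for n k
    using that by (simp add: coeff_eq_0 deg)
  have lead: "coeff (p n) n \<noteq> 0" if "n > 0" for n
    using that deg[of n] by (metis degree_0 leading_coeff_0_iff less_irrefl)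
  have "p 0 \<noteq> 0"
  proof
    assume "p 0 = 0"
    then have "(LBINT x:{-1<..<1}. ?w x * poly (p 0) x * poly (p 0) x) = 0"
      by simp
    then show False
      using orth by (simp add: orthonormal_polys_def)
  qed
  obtain k where p0: "p 0 = [:k:]" and "k \<noteq> 0"
    using deg[of 0] \<open>p 0 \<noteq> 0\<close> by (metis degree_eq_zeroE pCons_eq_0_iff)
  obtain e0 e2 where p2: "p 2 = [:e0, 0, e2:]" and "e2 \<noteq> 0"
    using expand[of 2] parity[of 2 1] vanish[of 2] lead[of 2] by auto
  obtain s3 t3 where p3: "p 3 = [:0, 1:] * [:s3, 0, t3:]" and "t3 \<noteq> 0"
    using expand[of 3] parity[of 3 0] parity[of 3 2] vanish[of 3] lead[of 3] by auto
  obtain s5 t5 u5 where p5: "p 5 = [:0, 1:] * [:s5, 0, t5, 0, u5:]" and "u5 \<noteq> 0"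
    using expand[of 5] parity[of 5 0] parity[of 5 2] parity[of 5 4] lead[of 5] by auto
  \<comment> \<open>The columns 3 and 5, restricted to the rows 0 and 2, are both multiples of \<open>(b 0, b 2)\<close>.\<close>
  obtain c d :: real where cd: "c \<noteq> 0 \<or> d \<noteq> 0" "c * a 3 + d * a 5 = 0"
  proof (cases "a 3 = 0")
    case True
    then show ?thesis using that[of 1 0] by simp
  next
    case False
    then show ?thesis using that[of "a 5" "- a 3"] by simp
  qed
  \<comment> \<open>Then \<open>x * q = c * p 3 + d * p 5\<close>, and the rows 0 and 2 annihilate this combination.\<close>
  define q where "q = smult c [:s3, 0, t3:] + smult d [:s5, 0, t5, 0, u5:]"
  have row: "konoplev_diff_form \<alpha> \<gamma> (p n) q = 0" if "n = 0 \<or> n = 2" for n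
  proof -
    have "konoplev_diff_form \<alpha> \<gamma> (p n) q = c * diff_matrix ?w p n 3 + d * diff_matrix ?w p n 5"
      unfolding q_def
      by (simp only: konoplev_diff_form_linear[OF assms(1,2)] diff_matrix_konoplev[where p = p and m = 3, OF assms(1,2) p3]
          diff_matrix_konoplev[where p = p and m = 5, OF assms(1,2) p5])
    also have "\<dots> = b n * (c * a 3 + d * a 5)"
      using that sep[of 3 n] sep[of 5 n] by (auto simp: algebra_simps)
    finally show ?thesis
      using cd by simp
  qed
  have "[:0, 0, 1:] * q = smult c ([:0, 1:] * p 3) + smult d ([:0, 1:] * p 5)"
    by (simp add: q_def p3 p5)
  then have "konoplev_functional \<alpha> \<gamma> ([:0, 0, 1:] * q) = 0"
    using orthonormal_polys_orthogonal[OF params orth, of "[:0, 1:]" 3]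
      orthonormal_polys_orthogonal[OF params orth, of "[:0, 1:]" 5]
    by (simp only: konoplev_functional_add[OF params] konoplev_functional_smult[OF params]) simp
  moreover have "q = [:c * s3 + d * s5, 0, c * t3 + d * t5, 0, d * u5:]"
    by (simp add: q_def)
  ultimately have "q = 0"
    using row[of 0] row[of 2] assms \<open>k \<noteq> 0\<close> \<open>e2 \<noteq> 0\<close>
    by (intro even_quartic_eq_0[OF assms(1,2)]) (auto simp: p0 p2)
  then have "c = 0 \<and> d = 0"
    using \<open>t3 \<noteq> 0\<close> \<open>u5 \<noteq> 0\<close> by (auto simp: q_def)
  with cd show False
    by simp
qed

end
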